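(* Let $n\ge 10$ with $n\equiv 2 \pmod 4$. Then there is no simple graph with $n$ vertices and $\frac14 n^2+1$ edges that has a maximal edge coloring; that is, $\frac14 n^2+1\notin MEC(n)$.
   Context: All graphs are finite and simple. The chromatic index of the complete graph is $\chi'(K_n)=n-1$ for even $n$ and $\chi'(K_n)=n$ for odd $n$. A graph $G$ of order $n$ has a maximal edge coloring if there is a proper edge coloring of $G$ using a palette of $\chi'(K_n)$ colors such that adding to $G$ any edge not already in $G$, in any color of the palette, makes the coloring improper (i.e., for every non-adjacent pair of distinct vertices $u,v$ and every color $c$ of the palette, $c$ already appears on an edge incident to $u$ or to $v$). $MEC(n)$ is the set of all nonnegative integers $m$ such that there exists a graph with $n$ vertices and $m$ edges having a maximal edge coloring. *)

theory Defs
  imports Main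
begin

definition all_edges :: "'a set \<Rightarrow> 'a set set" where
  "all_edges V = {e. e \<subseteq> V \<and> card e = 2}"

definition simple_graph :: "'a set \<Rightarrow> 'a set set \<Rightarrow> bool" where
  "simple_graph V E \<longleftrightarrow> finite V \<and> E \<subseteq> all_edges V"

definition proper_edge_coloring :: "'a set set \<Rightarrow> 'c set \<Rightarrow> ('a set \<Rightarrow> 'c) \<Rightarrow> bool" where
  "proper_edge_coloring E C f \<longleftrightarrow>
     (\<forall>e\<in>E. f e \<in> C) \<and>
     (\<forall>e\<in>E. \<forall>e'\<in>E. e \<noteq> e' \<and> e \<inter> e' \<noteq> {} \<longrightarrow> f e \<noteq> f e')"

definition chromatic_index :: "'a set set \<Rightarrow> nat" where
  "chromatic_index E = (LEAST k. \<exists>f. proper_edge_coloring E {..<k} f)"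

definition maximal_edge_coloring ::
  "'a set \<Rightarrow> 'a set set \<Rightarrow> 'c set \<Rightarrow> ('a set \<Rightarrow> 'c) \<Rightarrow> bool" where
  "maximal_edge_coloring V E C f \<longleftrightarrow>
     proper_edge_coloring E C f \<and>
     (\<forall>e \<in> all_edges V - E. \<forall>c\<in>C. \<not> proper_edge_coloring (insert e E) C (f(e := c)))"

text \<open>The palette has as many colors as the chromatic index of the complete graph
  on \<open>card V\<close> vertices, not that of the graph itself.\<close>

definition has_maximal_edge_coloring :: "'a set \<Rightarrow> 'a set set \<Rightarrow> bool" where
  "has_maximal_edge_coloring V E \<longleftrightarrow>
     (\<exists>f. maximal_edge_coloring V E {..<chromatic_index (all_edges {..<card V})} f)"

text \<open>Taking vertices in \<open>nat\<close> loses no generality, since every finite graph is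
  isomorphic to one on natural numbers.\<close>

definition MEC :: "nat \<Rightarrow> nat set" where
  "MEC n = {m. \<exists>(V :: nat set) E. simple_graph V E \<and> card V = n \<and> card E = m \<and>
                 has_maximal_edge_coloring V E}"

end

theory Submission
  imports Defs "HOL-Number_Theory.Cong"
begin

text \<open>
  Write \<open>n = 2k\<close>, \<open>k\<close> odd; the palette has \<open>2k - 1\<close> colours and two non-adjacent vertices together
  see all of them. So degrees of non-adjacent vertices sum to at least \<open>2k - 1\<close>, and the vertices
  missing a given colour form a clique, of even size.

  Suppose some vertex has degree \<open>\<delta> \<le> k - 2\<close>. Take \<open>u\<close> of minimum degree \<open>\<delta>\<close>, let \<open>T\<close> be the set of its
  colours, \<open>R\<close> its non-neighbours and \<open>N\<close> its closed neighbourhood. Vertices of \<open>R\<close> see every colour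
  outside \<open>T\<close>, so \<open>R\<close> and \<open>N\<close> are close to cliques, and two disjoint cliques of these sizes already
  force more than \<open>k\<^sup>2 + 1\<close> edges unless \<open>N\<close> lacks edges. A vertex of \<open>N\<close> seeing all of \<open>T\<close> has to
  compensate a missing edge by a \<open>T\<close>-coloured edge to \<open>R\<close>, while a vertex of \<open>N\<close> missing some colour
  of \<open>T\<close> is adjacent to every vertex of \<open>R\<close> missing it; both are too expensive.

  If all degrees are at least \<open>k - 1\<close>, then averaging and parity give a colour missing on more than \<open>k\<close>
  vertices, hence a clique \<open>A\<close> of size \<open>k + 1\<close>. Counting edges shows that the remaining \<open>k - 1\<close>
  vertices form a clique too, joined to \<open>A\<close> by exactly \<open>k\<close> edges, and a parity argument on the
  colours of these edges excludes this.
\<close>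

section \<open>Counting related pairs\<close>

definition pair_count :: "('a \<Rightarrow> 'b \<Rightarrow> bool) \<Rightarrow> 'a set \<Rightarrow> 'b set \<Rightarrow> nat" where
  "pair_count r X Y = (\<Sum>x\<in>X. card {y \<in> Y. r x y})"

lemma pair_count_swap:
  assumes "finite X" "finite Y"
  shows "pair_count r X Y = pair_count (\<lambda>y x. r x y) Y X"
proof -
  have "pair_count r X Y = (\<Sum>x\<in>X. \<Sum>y\<in>Y. if r x y then 1 else 0)"
    unfolding pair_count_def using assms
    by (intro sum.cong refl) (simp add: sum.If_cases Int_def)
  also have "\<dots> = (\<Sum>y\<in>Y. \<Sum>x\<in>X. if r x y then 1 else 0)"
    by (rule sum.swap)
  also have "\<dots> = pair_count (\<lambda>y x. r x y) Y X"
    unfolding pair_count_def using assms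
    by (intro sum.cong refl) (simp add: sum.If_cases Int_def)
  finally show ?thesis .
qed

lemma pair_count_symp:
  assumes "finite X" "finite Y" "symp r"
  shows "pair_count r X Y = pair_count r Y X"
proof -
  have "(\<lambda>y x. r x y) = r" using \<open>symp r\<close> by (auto simp: symp_def fun_eq_iff)
  then show ?thesis using pair_count_swap[OF assms(1,2), of r] by simp
qed

lemma pair_count_split_left:
  assumes "finite X" "X = A \<union> B" "A \<inter> B = {}"
  shows "pair_count r X Y = pair_count r A Y + pair_count r B Y"
  using assms(1,3) unfolding pair_count_def assms(2) by (auto intro: sum.union_disjoint)

lemma card_Collect_split:
  assumes "finite Y" "Y = A \<union> B" "A \<inter> B = {}"
  shows "card {y \<in> Y. p y} = card {y \<in> A. p y} + card {y \<in> B. p y}"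
proof -
  have "{y \<in> Y. p y} = {y \<in> A. p y} \<union> {y \<in> B. p y}" using assms(2) by blast
  moreover have "finite {y \<in> A. p y}" "finite {y \<in> B. p y}" using assms(1,2) by simp_all
  ultimately show ?thesis using assms(3) by (simp add: card_Un_disjoint disjoint_iff)
qed

lemma pair_count_split_right:
  assumes "finite Y" "Y = A \<union> B" "A \<inter> B = {}"
  shows "pair_count r X Y = pair_count r X A + pair_count r X B"
  unfolding pair_count_def by (simp only: card_Collect_split[OF assms] sum.distrib)

text \<open>Pairs come in mirror couples: a new vertex adds equally many in either order. The parity
  arguments on colour classes rest on this.\<close>

lemma even_pair_count:
  assumes "finite X" "symp r" "irreflp r"
  shows "even (pair_count r X X)"
  using assms(1)
proof (induction X rule: finite_induct)
  case empty
  then show ?case by (simp add: pair_count_def)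
next
  case (insert a X)
  have split: "finite (insert a X)" "insert a X = {a} \<union> X" "{a} \<inter> X = {}"
    using insert.hyps by auto
  have "pair_count r (insert a X) (insert a X) =
      pair_count r {a} {a} + pair_count r {a} X + (pair_count r X {a} + pair_count r X X)"
    unfolding pair_count_split_left[OF split] pair_count_split_right[OF split] by linarith
  moreover have "pair_count r X {a} = pair_count r {a} X"
    using insert.hyps assms by (intro pair_count_symp) auto
  moreover have "pair_count r {a} {a} = 0"
    using assms(3) by (auto simp: pair_count_def irreflp_def)
  ultimately show ?case using insert.IH by simp
qed

lemma sum_at_least_two:
  fixes h :: "'b \<Rightarrow> nat"
  assumes "finite S" "a \<in> S" "b \<in> S" "a \<noteq> b"
    and "\<And>x. x \<in> S - {a, b} \<Longrightarrow> m \<le> h x"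
  shows "h a + h b + card (S - {a, b}) * m \<le> sum h S"
proof -
  have "sum h S = sum h {a, b} + sum h (S - {a, b})"
    using assms by (metis empty_subsetI insert_subset sum.subset_diff add.commute)
  moreover have "card (S - {a, b}) * m \<le> sum h (S - {a, b})"
    using sum_bounded_below[of "S - {a, b}" m h] assms(5) by simp
  ultimately show ?thesis using assms(4) by simp
qed

section \<open>Maximal colorings on an even number of vertices\<close>

text \<open>The situation to be refuted: \<open>degree_sum\<close> is twice the edge count
  \<open>k\<^sup>2 + 1\<close>, and \<open>maximal\<close> states that the ends of a non-edge
  together see every colour.\<close>

locale maximal_coloring =
  fixes V :: "'a set" and adj :: "'a \<Rightarrow> 'a \<Rightarrow> bool" and col :: "'a \<Rightarrow> 'a \<Rightarrow> 'c"
    and P :: "'c set" and k :: nat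
  assumes finite_V: "finite V"
    and card_V: "card V = 2 * k"
    and finite_P: "finite P"
    and card_P: "card P = 2 * k - 1"
    and k_ge_5: "k \<ge> 5"
    and symp_adj: "symp adj"
    and irreflp_adj: "irreflp adj"
    and adj_V: "adj x y \<Longrightarrow> x \<in> V"
    and col_sym: "col x y = col y x"
    and col_P: "adj x y \<Longrightarrow> col x y \<in> P"
    and proper: "\<lbrakk>adj x y; adj x z; col x y = col x z\<rbrakk> \<Longrightarrow> y = z"
    and maximal: "\<lbrakk>x \<in> V; y \<in> V; x \<noteq> y; \<not> adj x y; c \<in> P\<rbrakk> \<Longrightarrow>
      (\<exists>z. adj x z \<and> col x z = c) \<or> (\<exists>z. adj y z \<and> col y z = c)"
    and degree_sum: "pair_count adj V V = 2 * k\<^sup>2 + 2"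
begin

definition nonadj :: "'a \<Rightarrow> 'a \<Rightarrow> bool" where
  "nonadj x y \<longleftrightarrow> x \<noteq> y \<and> \<not> adj x y"

text \<open>\<open>T = P\<close> gives back adjacency, a singleton \<open>T\<close> gives one colour
  class.\<close>

definition adj_in :: "'c set \<Rightarrow> 'a \<Rightarrow> 'a \<Rightarrow> bool" where
  "adj_in T x y \<longleftrightarrow> adj x y \<and> col x y \<in> T"

definition used :: "'a \<Rightarrow> 'c set" where
  "used x = col x ` {y. adj x y}"

definition deg :: "'a \<Rightarrow> nat" where
  "deg x = card {y \<in> V. adj x y}"

lemma adj_sym: "adj x y \<longleftrightarrow> adj y x"
  using symp_adj by (auto simp: symp_def)

lemma adj_irrefl [simp]: "\<not> adj x x"
  using irreflp_adj by (simp add: irreflp_def)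

lemma adj_V2: "adj x y \<Longrightarrow> y \<in> V"
  using adj_V adj_sym by blast

lemma symp_nonadj: "symp nonadj"
  using adj_sym by (auto simp: symp_def nonadj_def)

lemma irreflp_nonadj: "irreflp nonadj"
  by (auto simp: irreflp_def nonadj_def)

lemma symp_adj_in: "symp (adj_in T)"
  using adj_sym col_sym by (auto simp: symp_def adj_in_def)

lemma irreflp_adj_in: "irreflp (adj_in T)"
  by (auto simp: irreflp_def adj_in_def)

lemma used_P: "used x \<subseteq> P"
  using col_P by (auto simp: used_def)

lemma finite_used: "finite (used x)"
  using used_P finite_P finite_subset by blast

lemma used_Un: "\<lbrakk>x \<in> V; y \<in> V; nonadj x y\<rbrakk> \<Longrightarrow> used x \<union> used y = P"
proof
  assume xy: "x \<in> V" "y \<in> V" "nonadj x y"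
  show "used x \<union> used y \<subseteq> P" using used_P by blast
  show "P \<subseteq> used x \<union> used y"
  proof
    fix c
    assume "c \<in> P"
    then show "c \<in> used x \<union> used y"
      using maximal[of x y c] xy unfolding nonadj_def used_def by blast
  qed
qed

text \<open>Properness makes \<open>col x\<close> injective on the neighbours of \<open>x\<close>,
  so neighbours can be counted by colours.\<close>

lemma card_adj_in: "card {y \<in> V. adj_in T x y} = card (used x \<inter> T)"
proof -
  have "inj_on (col x) {y \<in> V. adj_in T x y}"
    using proper by (auto simp: inj_on_def adj_in_def)
  moreover have "col x ` {y \<in> V. adj_in T x y} = used x \<inter> T"
    using adj_V2 by (auto simp: adj_in_def used_def)
  ultimately show ?thesis using card_image by metis
qed

lemma adj_in_P: "adj_in P x y \<longleftrightarrow> adj x y"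
  using col_P by (auto simp: adj_in_def)

lemma deg_eq_card_used: "deg x = card (used x)"
proof -
  have "used x \<inter> P = used x" using used_P by blast
  then show ?thesis using card_adj_in[of P x] by (simp add: deg_def adj_in_P)
qed

lemma pair_count_adj_deg: "pair_count adj X V = (\<Sum>x\<in>X. deg x)"
  by (simp add: pair_count_def deg_def)

lemma deg_nonadj:
  assumes "x \<in> V" "y \<in> V" "nonadj x y"
  shows "2 * k - 1 \<le> deg x + deg y"
  using card_Un_le[of "used x" "used y"] used_Un[OF assms] card_P
  by (simp add: deg_eq_card_used)

lemma card_adj_nonadj:
  assumes "finite X" "x \<in> X"
  shows "card {y \<in> X. adj x y} + card {y \<in> X. nonadj x y} = card X - 1"
proof -
  have "{y \<in> X. adj x y} \<union> {y \<in> X. nonadj x y} = X - {x}"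
    by (auto simp: nonadj_def)
  moreover have "{y \<in> X. adj x y} \<inter> {y \<in> X. nonadj x y} = {}"
    by (auto simp: nonadj_def)
  ultimately have "card {y \<in> X. adj x y} + card {y \<in> X. nonadj x y} = card (X - {x})"
    using assms card_Un_disjoint[of "{y \<in> X. adj x y}" "{y \<in> X. nonadj x y}"] by simp
  then show ?thesis using assms by simp
qed

lemma pair_count_adj_nonadj:
  assumes "finite X"
  shows "pair_count adj X X + pair_count nonadj X X = card X * (card X - 1)"
  unfolding pair_count_def sum.distrib[symmetric]
  using card_adj_nonadj[OF assms] by simp

lemma pair_count_pos_iff:
  assumes "finite X" "finite Y"
  shows "0 < pair_count r X Y \<longleftrightarrow> (\<exists>x\<in>X. \<exists>y\<in>Y. r x y)"
proof -
  have "pair_count r X Y = 0 \<longleftrightarrow> (\<forall>x\<in>X. \<forall>y\<in>Y. \<not> r x y)"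
    unfolding pair_count_def using assms by auto
  then show ?thesis by auto
qed

section \<open>A vertex of small degree\<close>

lemma min_degree_ge:
  assumes u: "u \<in> V" and min: "\<And>x. x \<in> V \<Longrightarrow> deg u \<le> deg x"
  shows "k - 1 \<le> deg u"
proof (rule ccontr)
  assume "\<not> k - 1 \<le> deg u"
  then have \<delta>_small: "deg u + 2 \<le> k" by simp
  define T where "T = used u"
  define R where "R = {w \<in> V. nonadj u w}"
  define N where "N = V - R"
  define Z where "Z = {z \<in> N. \<not> T \<subseteq> used z}"
  define \<delta> where "\<delta> = deg u"
  define \<rho> where "\<rho> = card R"
  define g where "g = (\<Sum>w\<in>R. card (used w \<inter> T))"
  define x where "x z = card {w \<in> R. adj z w}" for z
  have fin: "finite V" "finite R" "finite N" "finite Z" "finite (N - Z)" "finite T"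
    using finite_V finite_used by (auto simp: R_def N_def Z_def T_def)
  have V_split: "V = R \<union> N" "R \<inter> N = {}" by (auto simp: N_def R_def)
  have N_split: "N = Z \<union> (N - Z)" "Z \<inter> (N - Z) = {}" by (auto simp: Z_def)
  have TP: "T \<subseteq> P" and cT: "card T = \<delta>"
    using used_P by (auto simp: T_def \<delta>_def deg_eq_card_used)
  have \<rho>_eq: "\<rho> + \<delta> = 2 * k - 1"
    using card_adj_nonadj[OF finite_V u] card_V by (simp add: \<rho>_def R_def \<delta>_def deg_def)
  have cN: "card N = \<delta> + 1"
  proof -
    have "card V = \<rho> + card N"
      unfolding \<rho>_def using V_split fin by (simp add: card_Un_disjoint)
    then show ?thesis using \<rho>_eq card_V k_ge_5 by linarith
  qed
  \<comment> \<open>Not being adjacent to \<open>u\<close>, such a \<open>w\<close> sees all \<rho>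
    colours outside \<open>T\<close>; \<open>g\<close> collects what \<open>T\<close> adds.\<close>
  have degR: "deg w = \<rho> + card (used w \<inter> T)" if "w \<in> R" for w
  proof -
    have "used u \<union> used w = P" using that u used_Un by (auto simp: R_def)
    then have "used w = (P - T) \<union> (used w \<inter> T)" using used_P by (auto simp: T_def)
    then have "card (used w) = card (P - T) + card (used w \<inter> T)"
      using fin finite_P card_Un_disjoint[of "P - T" "used w \<inter> T"] by force
    moreover have "card (P - T) = \<rho>"
      using card_Diff_subset[OF fin(6) TP] cT card_P \<rho>_eq by simp
    ultimately show ?thesis by (simp add: deg_eq_card_used)
  qed
  have RR: "pair_count adj R R + pair_count nonadj R R = \<rho> * (\<rho> - 1)"
    using pair_count_adj_nonadj[OF fin(2)] by (simp add: \<rho>_def)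
  have NN: "pair_count adj N N + pair_count nonadj N N = (\<delta> + 1) * \<delta>"
    using pair_count_adj_nonadj[OF fin(3)] cN by simp
  have RN: "pair_count adj R N = pair_count adj N R"
    by (rule pair_count_symp) (use fin symp_adj in auto)
  have sumR: "pair_count adj R R + pair_count adj N R = \<rho> * \<rho> + g"
  proof -
    have "pair_count adj R V = pair_count adj R R + pair_count adj R N"
      by (rule pair_count_split_right[OF fin(1) V_split])
    moreover have "pair_count adj R V = \<rho> * \<rho> + g"
      unfolding pair_count_adj_deg g_def using degR by (simp add: sum.distrib \<rho>_def)
    ultimately show ?thesis using RN by simp
  qed
  have sumN: "(\<Sum>z\<in>N. deg z) = pair_count adj N N + pair_count adj N R"
    unfolding pair_count_adj_deg[symmetric]
    using pair_count_split_right[OF fin(1) V_split, of adj N] by linarith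
  have total: "pair_count adj R R + 2 * pair_count adj N R + pair_count adj N N = 2 * k\<^sup>2 + 2"
  proof -
    have "pair_count adj V V = (\<Sum>z\<in>R. deg z) + (\<Sum>z\<in>N. deg z)"
      unfolding pair_count_adj_deg[symmetric]
      by (rule pair_count_split_left[OF fin(1) V_split])
    moreover have "(\<Sum>z\<in>R. deg z) = pair_count adj R R + pair_count adj N R"
      unfolding pair_count_adj_deg[symmetric]
      using pair_count_split_right[OF fin(1) V_split, of adj R] RN by linarith
    ultimately show ?thesis using degree_sum sumN by simp
  qed
  define F where "F = pair_count nonadj R R"
  define \<mu> where "\<mu> = pair_count nonadj N N"
  define \<alpha> where "\<alpha> = pair_count nonadj Z Z"
  define \<beta> where "\<beta> = pair_count nonadj (N - Z) Z"
  define \<gamma> where "\<gamma> = pair_count nonadj (N - Z) (N - Z)"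
  define X where "X = pair_count adj N R"
  \<comment> \<open>The surplus over the required degree sum if \<open>R\<close> and
    \<open>N\<close> were cliques and every vertex of \<open>R\<close> had degree exactly \<rho>.
    With \<open>k = \<delta> + 2 + s\<close> it equals \<open>2 * (s + 1) * (s + 2) - 2\<close>, so
    the subtraction does not truncate.\<close>
  define \<kappa> where "\<kappa> = \<rho> * (\<rho> + 1) + \<delta> * (\<delta> + 1) - (2 * k\<^sup>2 + 2)"
  have \<kappa>: "\<kappa> \<ge> 2" "\<rho> * (\<rho> + 1) + \<delta> * (\<delta> + 1) = 2 * k\<^sup>2 + 2 + \<kappa>"
  proof -
    obtain s where s: "k = \<delta> + 2 + s" using \<delta>_small le_Suc_ex \<delta>_def by blast
    then have r: "\<rho> = \<delta> + 3 + 2 * s" using \<rho>_eq by simp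
    have "\<rho> * (\<rho> + 1) + \<delta> * (\<delta> + 1) = 2 * k\<^sup>2 + 2 * (s + 1) * (s + 2)"
      unfolding r s power2_eq_square by (simp add: algebra_simps)
    moreover have "4 \<le> 2 * (s + 1) * (s + 2)" by simp
    ultimately show "\<kappa> \<ge> 2" "\<rho> * (\<rho> + 1) + \<delta> * (\<delta> + 1) = 2 * k\<^sup>2 + 2 + \<kappa>"
      unfolding \<kappa>_def by linarith+
  qed
  have \<delta>\<rho>: "\<delta> < \<rho>" "\<rho> \<ge> 1" using \<rho>_eq \<delta>_small \<delta>_def by linarith+
  have rr: "\<rho> * (\<rho> - 1) + \<rho> = \<rho> * \<rho>" using \<delta>\<rho> by (cases \<rho>) auto
  have rr2: "\<rho> * (\<rho> + 1) = \<rho> * \<rho> + \<rho>" by simp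
  have dd: "(\<delta> + 1) * \<delta> = \<delta> * (\<delta> + 1)" by simp
  have X_eq: "X = \<rho> + g + F"
    using RR sumR rr unfolding X_def F_def by linarith
  \<comment> \<open>The degree sum is fixed, so any surplus is paid for by missing pairs inside
    \<open>N\<close>.\<close>
  have \<mu>_eq: "\<mu> = 2 * g + F + \<kappa>"
    using RR sumR NN total \<kappa>(2) X_eq rr rr2 dd unfolding X_def F_def \<mu>_def
    by linarith
  have \<mu>_split: "\<mu> = \<alpha> + 2 * \<beta> + \<gamma>"
  proof -
    have "\<mu> = pair_count nonadj Z N + pair_count nonadj (N - Z) N"
      unfolding \<mu>_def by (rule pair_count_split_left[OF fin(3) N_split])
    moreover have "pair_count nonadj Z N = pair_count nonadj Z Z + pair_count nonadj Z (N - Z)"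
      by (rule pair_count_split_right[OF fin(3) N_split])
    moreover have "pair_count nonadj (N - Z) N = \<beta> + \<gamma>"
      unfolding \<beta>_def \<gamma>_def by (rule pair_count_split_right[OF fin(3) N_split])
    moreover have "pair_count nonadj Z (N - Z) = \<beta>"
      unfolding \<beta>_def by (rule pair_count_symp) (use fin symp_nonadj in auto)
    ultimately show ?thesis by (simp add: \<alpha>_def)
  qed
  \<comment> \<open>Here \<open>z\<close> sees all \<delta> colours of \<open>T\<close>, but
    \<open>N\<close> has only \<delta> other vertices; each non-neighbour in \<open>N\<close> forces
    a \<open>T\<close>-coloured edge to \<open>R\<close>.\<close>
  have outside: "card {y \<in> N. nonadj z y} \<le> card {y \<in> R. adj_in T z y}" if "z \<in> N - Z" for z
  proof -
    have "used z \<inter> T = T" using that by (auto simp: Z_def)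
    then have "card {y \<in> V. adj_in T z y} = \<delta>" using card_adj_in[of T z] cT by simp
    then have "card {y \<in> R. adj_in T z y} + card {y \<in> N. adj_in T z y} = \<delta>"
      using card_Collect_split[OF fin(1) V_split, of "adj_in T z"] by linarith
    moreover have "card {y \<in> N. adj_in T z y} \<le> card {y \<in> N. adj z y}"
      using fin by (intro card_mono) (auto simp: adj_in_def)
    moreover have "card {y \<in> N. adj z y} + card {y \<in> N. nonadj z y} = \<delta>"
      using card_adj_nonadj[OF fin(3), of z] that cN by simp
    ultimately show ?thesis by linarith
  qed
  have \<beta>\<gamma>: "\<beta> + \<gamma> = (\<Sum>z\<in>N - Z. card {y \<in> N. nonadj z y})"
    unfolding \<beta>_def \<gamma>_def pair_count_def[symmetric]
    by (rule pair_count_split_right[OF fin(3) N_split, symmetric])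
  \<comment> \<open>Seen from \<open>R\<close>, these edges are among the \<open>T\<close>-coloured
    ones that \<open>g\<close> counts.\<close>
  have \<beta>\<gamma>_le_g: "\<beta> + \<gamma> \<le> g"
  proof -
    have "\<beta> + \<gamma> \<le> pair_count (adj_in T) (N - Z) R"
      unfolding \<beta>\<gamma> pair_count_def using outside by (rule sum_mono)
    also have "\<dots> = pair_count (adj_in T) R (N - Z)"
      by (rule pair_count_symp) (use fin symp_adj_in in auto)
    also have "\<dots> \<le> pair_count (adj_in T) R V"
      unfolding pair_count_def using fin V_split
      by (intro sum_mono card_mono) auto
    also have "\<dots> = g" by (simp add: pair_count_def g_def card_adj_in)
    finally show ?thesis .
  qed
  have sum_x: "sum x Z + \<beta> + \<gamma> \<le> X"
  proof -
    have "X = sum x Z + pair_count adj (N - Z) R"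
      unfolding X_def x_def pair_count_def[symmetric]
      by (rule pair_count_split_left[OF fin(3) N_split])
    moreover have "card {y \<in> N. nonadj z y} \<le> card {y \<in> R. adj z y}" if "z \<in> N - Z" for z
      using outside[OF that] card_mono[of "{y \<in> R. adj z y}" "{y \<in> R. adj_in T z y}"] fin
      by (force simp: adj_in_def)
    then have "\<beta> + \<gamma> \<le> pair_count adj (N - Z) R"
      unfolding \<beta>\<gamma> pair_count_def by (rule sum_mono)
    ultimately show ?thesis by linarith
  qed
  \<comment> \<open>The part \<open>2 * \<beta> + \<gamma>\<close> of \<mu> is at most
    \<open>2 * g\<close>, which leaves at least \<kappa> for \<alpha>.\<close>
  have "0 < \<alpha>" using \<mu>_eq \<mu>_split \<beta>\<gamma>_le_g \<kappa>(1) by linarith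
  then obtain z1 z2 where z12: "z1 \<in> Z" "z2 \<in> Z" "nonadj z1 z2"
    unfolding \<alpha>_def pair_count_pos_iff[OF fin(4) fin(4)] by blast
  have z12_ne: "z1 \<noteq> z2" using z12 by (simp add: nonadj_def)
  have ZV: "z \<in> V" "z \<in> N" if "z \<in> Z" for z using that by (auto simp: Z_def N_def)
  \<comment> \<open>Lower bound for the degrees in \<open>N\<close>: the pair \<open>z1\<close>,
    \<open>z2\<close> contributes at least \<open>2 * k - 1 = \<rho> + \<delta>\<close>, every other
    vertex at least the minimum \<delta>. The exact sum is
    \<open>(\<delta> + 1) * \<delta> + \<rho> - g - \<kappa>\<close>.\<close>
  have gk: "g + \<kappa> \<le> \<delta>"
  proof -
    have "card (N - {z1, z2}) = \<delta> - 1"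
      using ZV z12 z12_ne cN fin by (simp add: card_Diff_subset)
    then have "deg z1 + deg z2 + (\<delta> - 1) * \<delta> \<le> (\<Sum>z\<in>N. deg z)"
      using sum_at_least_two[OF fin(3), of z1 z2 \<delta> deg] ZV z12 z12_ne min
      by (simp add: \<delta>_def N_def)
    moreover have "2 * k - 1 \<le> deg z1 + deg z2" using deg_nonadj ZV z12 by blast
    moreover have "(\<delta> - 1) * \<delta> + 2 * \<delta> \<ge> (\<delta> + 1) * \<delta>" by (cases \<delta>) auto
    ultimately show ?thesis
      using sumN NN X_eq \<mu>_eq \<rho>_eq unfolding X_def \<mu>_def by linarith
  qed
  \<comment> \<open>A non-adjacent pair in \<open>R\<close> would cover \<open>T\<close> and cost
    \<open>g\<close> at least \<delta>, against \<open>gk\<close>.\<close>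
  have F0: "F = 0"
  proof (rule ccontr)
    assume "F \<noteq> 0"
    then obtain w w' where w: "w \<in> R" "w' \<in> R" "nonadj w w'"
      unfolding F_def using pair_count_pos_iff[OF fin(2) fin(2), of nonadj] by auto
    then have "used w \<union> used w' = P" by (intro used_Un) (auto simp: R_def)
    then have "T \<subseteq> (used w \<inter> T) \<union> (used w' \<inter> T)" using TP by blast
    then have "\<delta> \<le> card (used w \<inter> T) + card (used w' \<inter> T)"
      using card_mono[of "(used w \<inter> T) \<union> (used w' \<inter> T)" T] fin cT
        card_Un_le[of "used w \<inter> T" "used w' \<inter> T"] by simp
    also have "\<dots> \<le> g"
      unfolding g_def using sum_at_least_two[OF fin(2), of w w' 0 "\<lambda>w. card (used w \<inter> T)"] w
      by (simp add: nonadj_def)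
    finally show False using gk \<kappa>(1) by linarith
  qed
  \<comment> \<open>Since \<open>g < \<rho>\<close>, each vertex of \<open>Z\<close>, and even more each non-adjacent pair in \<open>Z\<close>, sends many edges to
    \<open>R\<close>. Comparing with \<open>sum_x\<close>, non-adjacent pairs in \<open>Z\<close> cannot be disjoint, and then there are
    too few of them for \<open>\<mu>_split\<close>.\<close>
  define gc where "gc c = card {w \<in> R. c \<in> used w}" for c
  have gc_sum: "sum gc T = g"
  proof -
    have "g = pair_count (\<lambda>w c. c \<in> used w) R T"
      unfolding g_def pair_count_def by (simp add: Int_def conj_commute)
    also have "\<dots> = sum gc T"
      using pair_count_swap[OF fin(2) fin(6)] by (simp add: pair_count_def gc_def)
    finally show ?thesis by simp
  qed
  have x_ge: "\<rho> \<le> x z + gc c" if "z \<in> Z" "c \<in> T" "c \<notin> used z" for z c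
  proof -
    have "adj z w" if w: "w \<in> R" "c \<notin> used w" for w
    proof (rule ccontr)
      assume "\<not> adj z w"
      then have "nonadj z w" using w \<open>z \<in> Z\<close> V_split ZV by (auto simp: nonadj_def)
      then show False
        using used_Un[of z w] w ZV \<open>z \<in> Z\<close> \<open>c \<in> T\<close> \<open>c \<notin> used z\<close> TP V_split by blast
    qed
    then have "R \<subseteq> {w \<in> R. adj z w} \<union> {w \<in> R. c \<in> used w}" by blast
    then show ?thesis
      using card_mono[of "{w \<in> R. adj z w} \<union> {w \<in> R. c \<in> used w}" R] fin
        card_Un_le[of "{w \<in> R. adj z w}" "{w \<in> R. c \<in> used w}"]
      by (simp add: \<rho>_def x_def gc_def)
  qed
  have x_single: "2 \<le> x z" if z: "z \<in> Z" for z
  proof -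
    obtain c where c: "c \<in> T" "c \<notin> used z" using z by (auto simp: Z_def)
    have "gc c \<le> g" using member_le_sum[of c T gc] c fin gc_sum by simp
    then show ?thesis using x_ge[OF z c] gk \<kappa>(1) \<delta>\<rho> by linarith
  qed
  have x_pair: "\<rho> + \<kappa> \<le> x z + x z'" if z: "z \<in> Z" "z' \<in> Z" "nonadj z z'" for z z'
  proof -
    obtain c where c: "c \<in> T" "c \<notin> used z" using z by (auto simp: Z_def)
    obtain c' where c': "c' \<in> T" "c' \<notin> used z'" using z by (auto simp: Z_def)
    \<comment> \<open>Non-adjacent vertices cannot miss the same colour, so the two losses
      \<open>gc c\<close> and \<open>gc c'\<close> share the single budget \<open>g\<close>.\<close>
    have "c \<noteq> c'" using used_Un[of z z'] z ZV c c' TP by blast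
    then have "gc c + gc c' \<le> g"
      using sum_at_least_two[OF fin(6), of c c' 0 gc] c c' gc_sum by simp
    then show ?thesis using x_ge[OF z(1) c] x_ge[OF z(2) c'] gk \<delta>\<rho> by linarith
  qed
  define Y where "Y = Z - {z1, z2}"
  have Z_eq: "Z = {z1, z2} \<union> Y" "{z1, z2} \<inter> Y = {}" and finY: "finite Y"
    using z12 fin by (auto simp: Y_def)
  have sum_Y: "x z1 + x z2 + sum x Y = sum x Z"
  proof -
    have "sum x Z = sum x {z1, z2} + sum x Y"
      unfolding Z_eq(1) by (rule sum.union_disjoint) (use Z_eq(2) finY in auto)
    then show ?thesis using z12_ne by simp
  qed
  have no_pair: "\<not> nonadj z z'" if z: "z \<in> Y" "z' \<in> Y" for z z'
  proof
    assume n: "nonadj z z'"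
    have "x z + x z' \<le> sum x Y"
      using sum_at_least_two[OF finY, of z z' 0 x] z n by (simp add: nonadj_def)
    moreover have "\<rho> + \<kappa> \<le> x z + x z'" using x_pair n z by (simp add: Y_def)
    ultimately show False
      using sum_Y x_pair[OF z12] sum_x X_eq F0 \<mu>_eq \<mu>_split gk \<delta>\<rho> \<kappa>(1) by linarith
  qed
  \<comment> \<open>All non-adjacent pairs in \<open>Z\<close> meet \<open>{z1, z2}\<close>: two
    ordered pairs for \<open>z1\<close>, \<open>z2\<close> themselves and at most four for each
    vertex of \<open>Y\<close>.\<close>
  have \<alpha>_le: "\<alpha> \<le> 2 + 4 * card Y"
  proof -
    have "\<alpha> = pair_count nonadj {z1, z2} {z1, z2} + pair_count nonadj {z1, z2} Y
        + (pair_count nonadj Y {z1, z2} + pair_count nonadj Y Y)"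
      unfolding \<alpha>_def pair_count_split_left[OF fin(4) Z_eq]
        pair_count_split_right[OF fin(4) Z_eq] by linarith
    moreover have "pair_count nonadj Y Y = 0"
      using no_pair pair_count_pos_iff[OF finY finY, of nonadj] by auto
    moreover have "pair_count nonadj {z1, z2} Y = pair_count nonadj Y {z1, z2}"
      by (rule pair_count_symp) (use finY symp_nonadj in auto)
    moreover have "pair_count nonadj Y {z1, z2} \<le> card Y * 2"
    proof -
      have "card {y \<in> {z1, z2}. nonadj z y} \<le> 2" for z
        using card_mono[of "{z1, z2}" "{y \<in> {z1, z2}. nonadj z y}"] z12_ne by force
      then have "pair_count nonadj Y {z1, z2} \<le> (\<Sum>z\<in>Y. 2)"
        unfolding pair_count_def by (intro sum_mono)
      then show ?thesis by simp
    qed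
    moreover have "pair_count nonadj {z1, z2} {z1, z2} \<le> 2"
      using pair_count_adj_nonadj[of "{z1, z2}"] z12_ne by simp
    ultimately show ?thesis by linarith
  qed
  \<comment> \<open>Now \<open>2 * card Y\<close> is at most
    \<open>g - \<kappa> - \<beta> - \<gamma>\<close>. Inserted into \<open>\<alpha>_le\<close>, with
    \<alpha> equal to \<open>2 * g + \<kappa> - 2 * \<beta> - \<gamma>\<close>, this gives
    \<open>3 * \<kappa> + \<gamma> \<le> 2\<close>, contradicting
    \<open>\<kappa> \<ge> 2\<close>.\<close>
  have "2 * card Y \<le> sum x Y"
    using sum_bounded_below[of Y 2 x] x_single by (simp add: Y_def mult.commute)
  then show False
    using \<alpha>_le sum_Y x_pair[OF z12] sum_x X_eq F0 \<mu>_eq \<mu>_split \<kappa>(1) by linarith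
qed

section \<open>All degrees at least \<open>k - 1\<close>\<close>

lemma pair_count_color:
  assumes "finite X"
  shows "pair_count (adj_in {c}) X V = card {x \<in> X. c \<in> used x}"
proof -
  have "card {y \<in> V. adj_in {c} x y} = (if c \<in> used x then 1 else 0)" for x
    by (auto simp: card_adj_in)
  then show ?thesis
    unfolding pair_count_def using assms by (simp add: sum.If_cases Int_def)
qed

text \<open>A colour class is a matching, so it covers evenly many of the \<open>2 * k\<close>
  vertices.\<close>

lemma even_card_missing: "even (card {x \<in> V. c \<notin> used x})"
proof -
  have "even (card {x \<in> V. c \<in> used x})"
    unfolding pair_count_color[OF finite_V, symmetric]
    by (rule even_pair_count[OF finite_V symp_adj_in irreflp_adj_in])
  moreover have "{x \<in> V. c \<notin> used x} = V - {x \<in> V. c \<in> used x}" by blast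
  ultimately show ?thesis using finite_V card_V by (simp add: card_Diff_subset)
qed

lemma missing_clique:
  assumes "c \<in> P" "x \<in> V" "y \<in> V" "c \<notin> used x" "c \<notin> used y" "x \<noteq> y"
  shows "adj x y"
  using used_Un[of x y] assms by (auto simp: nonadj_def)

text \<open>The missing incidences number \<open>2 * k * (2 * k - 1) - (2 * k\<^sup>2 + 2)\<close>,
  which exceeds \<open>(2 * k - 1) * (k - 1)\<close> by \<open>k - 3\<close>. So some colour is
  missing at \<open>k\<close> or more vertices, and parity rules out exactly
  \<open>k\<close>.\<close>

lemma ex_large_clique:
  assumes "odd k"
  obtains A where "A \<subseteq> V" "card A = k + 1" "\<And>x y. \<lbrakk>x \<in> A; y \<in> A; x \<noteq> y\<rbrakk> \<Longrightarrow> adj x y"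
proof -
  define m where "m c = card {x \<in> V. c \<notin> used x}" for c
  have "\<exists>c\<in>P. k < m c"
  proof (rule ccontr)
    assume no: "\<not> (\<exists>c\<in>P. k < m c)"
    have small: "m c \<le> k - 1" if "c \<in> P" for c
    proof -
      have "m c \<noteq> k" using even_card_missing[of c] assms unfolding m_def by metis
      moreover have "\<not> k < m c" using no that by blast
      ultimately show ?thesis by linarith
    qed
    have "sum m P = (\<Sum>x\<in>V. card {c \<in> P. c \<notin> used x})"
      using pair_count_swap[OF finite_P finite_V, of "\<lambda>c x. c \<notin> used x"]
      by (simp add: pair_count_def m_def)
    moreover have "card {c \<in> P. c \<notin> used x} + deg x = 2 * k - 1" for x
    proof -
      have "{c \<in> P. c \<notin> used x} = P - used x" by blast
      then have "card {c \<in> P. c \<notin> used x} = card P - deg x"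
        using card_Diff_subset[OF finite_used used_P] by (simp add: deg_eq_card_used)
      moreover have "deg x \<le> card P"
        using card_mono[OF finite_P used_P] by (simp add: deg_eq_card_used)
      ultimately show ?thesis using card_P by simp
    qed
    then have "(\<Sum>x\<in>V. card {c \<in> P. c \<notin> used x}) + sum deg V = (2 * k) * (2 * k - 1)"
      using card_V by (simp add: sum.distrib[symmetric])
    moreover have "sum deg V = 2 * k\<^sup>2 + 2"
      using degree_sum by (simp add: pair_count_adj_deg)
    moreover have "sum m P \<le> (2 * k - 1) * (k - 1)"
      using sum_bounded_above[of P m "k - 1"] small card_P by simp
    moreover obtain s where "k = s + 5" using k_ge_5 le_Suc_ex by (metis add.commute)
    ultimately show False by (simp add: algebra_simps power2_eq_square)
  qed
  then obtain c where c: "c \<in> P" "k + 1 \<le> m c" by auto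
  then obtain A where "A \<subseteq> {x \<in> V. c \<notin> used x}" "card A = k + 1"
    unfolding m_def by (metis obtain_subset_with_card_n)
  then show thesis using that missing_clique[OF c(1)] by blast
qed

lemma max_min_degree:
  assumes "odd k" and min: "\<And>x. x \<in> V \<Longrightarrow> k - 1 \<le> deg x"
  shows False
proof -
  obtain A where A: "A \<subseteq> V" "card A = k + 1"
    and clique: "\<And>x y. \<lbrakk>x \<in> A; y \<in> A; x \<noteq> y\<rbrakk> \<Longrightarrow> adj x y"
    using ex_large_clique[OF \<open>odd k\<close>] by blast
  define B where "B = V - A"
  have fin: "finite A" "finite B" using A finite_V finite_subset by (auto simp: B_def)
  have V_split: "V = A \<union> B" "A \<inter> B = {}" using A by (auto simp: B_def)
  have cB: "card B = k - 1"
    unfolding B_def using card_Diff_subset[OF fin(1) A(1)] A card_V by simp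
  define X where "X = pair_count adj B A"
  define H where "H = pair_count nonadj B B"
  have AB: "pair_count adj A B = X"
    unfolding X_def by (rule pair_count_symp) (use fin symp_adj in auto)
  have AA: "pair_count adj A A = (k + 1) * k"
  proof -
    have "pair_count nonadj A A = 0"
      using clique pair_count_pos_iff[OF fin(1) fin(1), of nonadj] by (auto simp: nonadj_def)
    then show ?thesis using pair_count_adj_nonadj[OF fin(1)] A by simp
  qed
  have BB: "pair_count adj B B + H = (k - 1) * (k - 2)"
    using pair_count_adj_nonadj[OF fin(2)] cB by (simp add: H_def numeral_2_eq_2)
  have sumB: "sum deg B = pair_count adj B B + X"
    unfolding pair_count_adj_deg[symmetric]
    using pair_count_split_right[OF finite_V V_split, of adj B] by (simp add: X_def)
  have "pair_count adj V V = (pair_count adj A A + X) + sum deg B"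
    unfolding pair_count_split_left[OF finite_V V_split]
    using pair_count_split_right[OF finite_V V_split, of adj A] AB
    by (simp add: pair_count_adj_deg)
  then have total: "(k + 1) * k + 2 * X + (k - 1) * (k - 2) = 2 * k\<^sup>2 + 2 + H"
    using degree_sum sumB AA BB by linarith
  obtain s where s: "k = s + 5" using k_ge_5 le_Suc_ex by (metis add.commute)
  have X_eq: "2 * X = 2 * k + H"
    using total unfolding s by (simp add: algebra_simps power2_eq_square)
  have sumB': "sum deg B + H + k = (k - 1) * (k - 1) + X + 1"
    using sumB BB X_eq unfolding s by (simp add: algebra_simps)
  have minB: "k - 1 \<le> deg x" if "x \<in> B" for x using min that by (simp add: B_def)
  define e where "e x = deg x - (k - 1)" for x
  have deg_e: "deg x = k - 1 + e x" if "x \<in> B" for x using minB[OF that] by (simp add: e_def)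
  have excess: "sum deg B = (k - 1) * (k - 1) + sum e B"
  proof -
    have "sum deg B = (\<Sum>x\<in>B. k - 1 + e x)"
      using deg_e by (intro sum.cong) auto
    then show ?thesis using cB by (simp only: sum.distrib sum_constant of_nat_id)
  qed
  have sum_e: "sum e B + H + k = X + 1" using sumB' excess by simp
  \<comment> \<open>Together, \<open>sum_e\<close> and \<open>X_eq\<close> give
    \<open>2 * sum e B + H = 2\<close>. If \<open>H\<close> were positive, all of \<open>B\<close>
    would have degree \<open>k - 1\<close>, too little for a non-adjacent pair.\<close>
  have H0: "H = 0"
  proof (rule ccontr)
    assume "H \<noteq> 0"
    then obtain x y where xy: "x \<in> B" "y \<in> B" "nonadj x y"
      unfolding H_def using pair_count_pos_iff[OF fin(2) fin(2), of nonadj] by auto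
    have "sum e B = 0" using sum_e X_eq \<open>H \<noteq> 0\<close> by linarith
    then have "deg z = k - 1" if "z \<in> B" for z using fin(2) that deg_e by simp
    moreover have "x \<in> V" "y \<in> V" using xy by (simp_all add: B_def)
    ultimately show False using deg_nonadj[of x y] xy k_ge_5 by fastforce
  qed
  then have Xk: "X = k" using X_eq by simp
  have cliqueB: "adj x y" if "x \<in> B" "y \<in> B" "x \<noteq> y" for x y
  proof -
    have "\<not> nonadj x y"
      using H0 that pair_count_pos_iff[OF fin(2) fin(2), of nonadj] unfolding H_def by auto
    then show ?thesis using that by (simp add: nonadj_def)
  qed
  have degB: "card {y \<in> A. adj x y} + (k - 2) = deg x" if "x \<in> B" for x
  proof -
    have "{y \<in> B. adj x y} = B - {x}" using cliqueB that by auto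
    then have "card {y \<in> B. adj x y} = k - 2" using that cB fin by simp
    then show ?thesis
      using card_Collect_split[OF finite_V V_split, of "adj x"] by (simp add: deg_def)
  qed
  have "sum e B = 1" using sum_e H0 Xk by simp
  then obtain u where u: "u \<in> B" "e u = 1"
    and others: "\<And>x. \<lbrakk>x \<in> B; x \<noteq> u\<rbrakk> \<Longrightarrow> e x = 0"
    unfolding sum_eq_1_iff[OF fin(2)] by metis
  have deg_u: "deg u = k" using deg_e[OF u(1)] u k_ge_5 by simp
  have deg_B: "deg x = k - 1" if "x \<in> B" "x \<noteq> u" for x
    using others[OF that] deg_e[OF that(1)] by simp
  \<comment> \<open>Only \<open>k\<close> edges leave \<open>A\<close>, which has
    \<open>k + 1\<close> vertices.\<close>
  have "\<exists>v\<in>A. \<forall>y\<in>B. \<not> adj v y"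
  proof (rule ccontr)
    assume "\<not> ?thesis"
    then have "1 \<le> card {y \<in> B. adj v y}" if "v \<in> A" for v
      using that fin by (force simp: Suc_le_eq card_gt_0_iff)
    then have "card A * 1 \<le> pair_count adj A B"
      unfolding pair_count_def using sum_bounded_below[of A 1 "\<lambda>v. card {y \<in> B. adj v y}"] by simp
    then show False using AB Xk A by simp
  qed
  then obtain v where v: "v \<in> A" "\<And>y. y \<in> B \<Longrightarrow> \<not> adj v y" by blast
  \<comment> \<open>Every vertex of \<open>B\<close> is non-adjacent to \<open>v\<close> and so sees
    all of \<open>T\<close>. By size, \<open>T\<close> is exactly what a vertex of \<open>B\<close>
    other than \<open>u\<close> sees, while \<open>u\<close> sees one colour more.\<close>
  define T where "T = P - used v"
  have "deg v = k"
  proof -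
    have "{y \<in> V. adj v y} = A - {v}" using v clique V_split by auto
    then show ?thesis using v A fin by (simp add: deg_def)
  qed
  then have cT: "card T = k - 1"
    unfolding T_def using card_Diff_subset[OF finite_used used_P] card_P
    by (simp add: deg_eq_card_used)
  have T_used: "T \<subseteq> used x" if "x \<in> B" for x
  proof -
    have "nonadj v x" "v \<in> V" "x \<in> V" using v that V_split by (auto simp: nonadj_def)
    then show ?thesis using used_Un[of v x] by (auto simp: T_def)
  qed
  have used_B: "used x = T" if "x \<in> B" "x \<noteq> u" for x
    using card_subset_eq[OF finite_used T_used[OF that(1)]] deg_B[OF that] cT
    by (simp add: deg_eq_card_used)
  \<comment> \<open>The edge at \<open>u\<close> with the extra colour cannot end in
    \<open>B\<close>, where the other vertices see only \<open>T\<close>.\<close>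
  obtain w where w: "w \<in> A" "adj u w" "col u w \<notin> T"
  proof -
    have "card (used u) \<noteq> card T" using deg_u cT k_ge_5 by (simp add: deg_eq_card_used)
    then have "used u \<noteq> T" by blast
    then obtain c where "c \<in> used u" "c \<notin> T" using T_used[OF u(1)] by blast
    then obtain w where w: "adj u w" "col u w \<notin> T" by (auto simp: used_def)
    have "w \<notin> B"
    proof
      assume "w \<in> B"
      moreover have "w \<noteq> u" using w by auto
      moreover have "col u w \<in> used w"
        using w adj_sym col_sym by (auto simp: used_def image_iff)
      ultimately show False using used_B w by blast
    qed
    then have "w \<in> A" using w adj_V2 V_split by blast
    then show thesis using that w by blast
  qed
  have cB': "card (B - {u}) = k - 2" using cB u(1) fin(2) by simp
  have odd_B': "odd (card (B - {u}))" unfolding cB' using \<open>odd k\<close> k_ge_5 by simp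
  \<comment> \<open>The colour \<open>col u w\<close> is missing on \<open>B - {u}\<close>, an odd set, so it is missing in \<open>A\<close> too.\<close>
  obtain v' where v': "v' \<in> A" "\<And>x. \<lbrakk>x \<in> B; x \<noteq> u\<rbrakk> \<Longrightarrow> adj v' x"
  proof -
    define S where "S = {x \<in> V. col u w \<notin> used x}"
    have "u \<notin> S" using w by (auto simp: S_def used_def)
    moreover have "B - {u} \<subseteq> S" using used_B w(3) unfolding S_def B_def by auto
    moreover have "S \<noteq> B - {u}"
      using even_card_missing[of "col u w"] odd_B' unfolding S_def by metis
    ultimately obtain v' where v': "v' \<in> S" "v' \<notin> B" by blast
    then have "v' \<in> V" "v' \<in> A" "col u w \<notin> used v'" by (simp_all add: S_def B_def)
    moreover have "adj v' x" if x: "x \<in> B" "x \<noteq> u" for x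
    proof (rule missing_clique)
      show "col u w \<in> P" using col_P w by blast
      have "x \<in> S" using x \<open>B - {u} \<subseteq> S\<close> by blast
      then show "x \<in> V" "col u w \<notin> used x" by (simp_all add: S_def)
      show "v' \<noteq> x" using v' x by blast
    qed fact+
    ultimately show thesis using that v' by blast
  qed
  \<comment> \<open>Degree \<open>k - 1\<close> leaves one edge to \<open>A\<close> beside the
    \<open>k - 2\<close> inside \<open>B\<close>.\<close>
  have only_v': "y = v'" if "x \<in> B" "x \<noteq> u" "y \<in> A" "adj x y" for x y
  proof -
    have "card {y \<in> A. adj x y} = 1" using degB deg_B that k_ge_5 by fastforce
    moreover have "y \<in> {y \<in> A. adj x y}" "v' \<in> {y \<in> A. adj x y}"
      using that v' adj_sym by auto
    ultimately show ?thesis by (metis card_1_singletonE singletonD)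
  qed
  \<comment> \<open>Every colour of \<open>T\<close> occurs on an even number of edges between \<open>A\<close> and \<open>B\<close>, so the
    colour of \<open>v'x\<close> has to recur at \<open>u\<close>, the only other vertex it can reach \<open>A\<close> from.\<close>
  have recur: "\<exists>y\<in>A. adj u y \<and> col u y = col x v'" if x: "x \<in> B" "x \<noteq> u" for x
  proof -
    define d where "d = col x v'"
    have xv: "adj x v'" using v' x adj_sym by blast
    then have "d \<in> used x" by (auto simp: d_def used_def)
    then have dT: "d \<in> T" using used_B x by blast
    have "{x \<in> B. d \<in> used x} = B" using T_used dT by blast
    then have "pair_count (adj_in {d}) B V = k - 1"
      using pair_count_color[OF fin(2)] cB by simp
    then have "even (pair_count (adj_in {d}) B V)" using \<open>odd k\<close> by simp
    then have ev: "even (pair_count (adj_in {d}) B A)"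
      unfolding pair_count_split_right[OF finite_V V_split]
      using even_pair_count[OF fin(2) symp_adj_in irreflp_adj_in, of "{d}"] by simp
    have "adj_in {d} x v'" using xv by (simp add: adj_in_def d_def)
    then have x_one: "{y \<in> A. adj_in {d} x y} = {v'}"
      using only_v'[OF x] v'(1) unfolding adj_in_def by blast
    have "pair_count (adj_in {d}) B A = 1 + pair_count (adj_in {d}) (B - {x}) A"
      unfolding pair_count_def 
      using sum.remove[OF fin(2) x(1), of "\<lambda>x. card {y \<in> A. adj_in {d} x y}"] x_one by simp
    then have "0 < pair_count (adj_in {d}) (B - {x}) A" using ev by (auto intro: gr0I)
    then obtain x' y where x': "x' \<in> B" "x' \<noteq> x" "y \<in> A" "adj_in {d} x' y"
      using pair_count_pos_iff[of "B - {x}" A "adj_in {d}"] fin by auto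
    have "x' = u"
    proof (rule ccontr)
      assume "x' \<noteq> u"
      then have "y = v'" using only_v' x' by (auto simp: adj_in_def)
      then have "adj x' v'" "col x' v' = d" using x' by (simp_all add: adj_in_def)
      then have "x = x'"
        using proper[of v' x x'] xv adj_sym[of v'] col_sym[of v'] by (simp add: d_def)
      then show False using x'(2) by simp
    qed
    then show ?thesis using x'(3,4) unfolding adj_in_def d_def by blast
  qed
  \<comment> \<open>Two vertices of \<open>B - {u}\<close> give two recurring colours at
    \<open>u\<close>. With the edge to \<open>w\<close> this makes three neighbours of
    \<open>u\<close> in \<open>A\<close>, but its degree \<open>k\<close> allows only two.\<close>
  have "B - {u} \<noteq> {}" using cB' k_ge_5 by force
  then obtain x1 where x1: "x1 \<in> B - {u}" by blast
  have "card (B - {u} - {x1}) = k - 3" using cB' x1 fin(2) by (simp only: card_Diff_singleton)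
  then have "B - {u} - {x1} \<noteq> {}" using k_ge_5 by force
  then obtain x2 where x2: "x2 \<in> B - {u}" "x2 \<noteq> x1" by blast
  obtain y1 where y1: "y1 \<in> A" "adj u y1" "col u y1 = col x1 v'" using recur[of x1] x1 by blast
  obtain y2 where y2: "y2 \<in> A" "adj u y2" "col u y2 = col x2 v'" using recur[of x2] x2 by blast
  have xv: "adj v' x1" "adj v' x2" using v' x1 x2 by auto
  then have "col x1 v' \<noteq> col x2 v'" using proper[of v' x1 x2] x2(2) col_sym[of v'] by auto
  then have "y1 \<noteq> y2" using y1(3) y2(3) by metis
  moreover have "col x1 v' \<in> T" "col x2 v' \<in> T"
    using used_B[of x1] used_B[of x2] x1 x2 xv adj_sym[of v'] unfolding used_def by blast+
  then have "w \<noteq> y1" "w \<noteq> y2" using y1(3) y2(3) w(3) by metis+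
  ultimately have "card {w, y1, y2} = 3" by simp
  moreover have "card {w, y1, y2} \<le> card {y \<in> A. adj u y}"
    using y1 y2 w fin(1) by (intro card_mono) auto
  ultimately show False using degB[OF u(1)] deg_u k_ge_5 by linarith
qed

lemma no_such_coloring:
  assumes "odd k"
  shows False
proof -
  have "V \<noteq> {}" using card_V k_ge_5 by auto
  then obtain u where u: "u \<in> V" "\<And>x. x \<in> V \<Longrightarrow> deg u \<le> deg x"
    using arg_min_if_finite(1)[OF finite_V, of deg] arg_min_least[OF finite_V, of _ deg] by blast
  then have "k - 1 \<le> deg x" if "x \<in> V" for x
    using min_degree_ge[OF u] u(2)[OF that] by linarith
  then show False using max_min_degree[OF assms] by blast
qed

end

section \<open>The chromatic index of complete graphs of even order\<close>

lemma in_all_edgesE: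
  assumes "e \<in> all_edges V"
  obtains a b where "e = {a, b}" "a \<noteq> b" "a \<in> V" "b \<in> V"
  using assms by (auto simp: all_edges_def card_2_iff)

lemma pair_in_all_edges: "{a, b} \<in> all_edges V \<longleftrightarrow> a \<in> V \<and> b \<in> V \<and> a \<noteq> b"
  by (auto simp: all_edges_def card_2_iff doubleton_eq_iff)

lemma complete_graph_coloring:
  assumes "odd N"
  shows "\<exists>f. proper_edge_coloring (all_edges {..<Suc N}) {..<N} f"
proof -
  \<comment> \<open>Round-robin: the vertices below \<open>N\<close> are the residues modulo \<open>N\<close>, and the edge from \<open>a\<close> to
    the extra vertex \<open>N\<close> gets the one colour \<open>2 * a\<close> that the edges \<open>{a, b}\<close> leave free.\<close>
  define h where "h a b = (if a = N then 2 * b else if b = N then 2 * a else a + b) mod N"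
    for a b :: nat
  \<comment> \<open>\<open>Min\<close> and \<open>Max\<close> merely read off the two ends of an
    edge; by \<open>h_sym\<close> their order is immaterial.\<close>
  define f where "f e = h (Min e) (Max e)" for e :: "nat set"
  have N: "N > 0" using assms by (rule odd_pos)
  have h_sym: "h a b = h b a" if "a \<noteq> b" for a b
    using that by (simp add: h_def add.commute)
  have f: "f {a, b} = h a b" if "a \<noteq> b" for a b
  proof (cases "a < b")
    case True
    then show ?thesis by (simp add: f_def)
  next
    case False
    then have "f {a, b} = h b a" using that by (simp add: f_def)
    then show ?thesis using h_sym that by simp
  qed
  have canc: "x = y" if "x < N" "y < N" "[x = y] (mod N)" for x y
    using that by (simp add: cong_def)
  have dbl: "x = y" if "x < N" "y < N" "[2 * x = 2 * y] (mod N)" for x y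
    using that canc assms cong_mult_lcancel_nat[of 2 N x y] by (simp add: coprime_left_2_iff_odd)
  have h_inj: "b = d"
    if le: "a \<le> N" "b \<le> N" "d \<le> N" and ne: "a \<noteq> b" "a \<noteq> d" and eq: "h a b = h a d" for a b d
  proof (cases "a = N")
    case True
    then show ?thesis using dbl[of b d] le ne eq by (simp add: h_def cong_def)
  next
    case False
    then have a: "a < N" using le by simp
    \<comment> \<open>The colour \<open>2 * a\<close> of the edge from \<open>a\<close> to
      \<open>N\<close> could recur at \<open>a\<close> only on a loop.\<close>
    have mix: "x = a" if "x < N" "[2 * a = a + x] (mod N)" for x
      using that a canc[of a x] cong_add_lcancel_nat[of a a x N] by (simp add: mult_2)
    consider "b = N" "d = N" | "b = N" "d < N" | "b < N" "d = N" | "b < N" "d < N"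
      using le by linarith
    then show ?thesis
    proof cases
      case 2
      then show ?thesis using mix[of d] ne eq a by (simp add: h_def cong_def)
    next
      case 3
      then show ?thesis using mix[of b] ne eq a by (simp add: h_def cong_def)
    next
      case 4
      then show ?thesis
        using canc[of b d] cong_add_lcancel_nat[of a b d N] eq a by (simp add: h_def cong_def)
    qed simp
  qed
  have "proper_edge_coloring (all_edges {..<Suc N}) {..<N} f"
    unfolding proper_edge_coloring_def
  proof (intro conjI ballI impI)
    fix e
    assume "e \<in> all_edges {..<Suc N}"
    then show "f e \<in> {..<N}" using N by (simp add: f_def h_def)
  next
    fix e e'
    assume e: "e \<in> all_edges {..<Suc N}" "e' \<in> all_edges {..<Suc N}"
      and ne: "e \<noteq> e' \<and> e \<inter> e' \<noteq> {}"
    obtain a where a: "a \<in> e" "a \<in> e'" using ne by blast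
    obtain b where b: "e = {a, b}" "a \<noteq> b" "a \<le> N" "b \<le> N"
      using e(1) a(1) by (elim in_all_edgesE) (auto simp: less_Suc_eq_le insert_commute)
    obtain d where d: "e' = {a, d}" "a \<noteq> d" "d \<le> N"
      using e(2) a(2) by (elim in_all_edgesE) (auto simp: less_Suc_eq_le insert_commute)
    show "f e \<noteq> f e'" using h_inj[of a b d] b d ne f by metis
  qed
  then show ?thesis by blast
qed

text \<open>The \<open>N\<close> edges at the vertex \<open>N\<close> pairwise meet, so their
  colours differ.\<close>

lemma complete_graph_coloring_ge:
  assumes "proper_edge_coloring (all_edges {..<Suc N}) {..<m} f"
  shows "N \<le> m"
proof -
  have E: "{N, j} \<in> all_edges {..<Suc N}" if "j < N" for j
    using that by (simp add: pair_in_all_edges)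
  have "inj_on (\<lambda>j. f {N, j}) {..<N}"
  proof (rule inj_onI)
    fix i j
    assume ij: "i \<in> {..<N}" "j \<in> {..<N}" "f {N, i} = f {N, j}"
    then have "{N, i} \<in> all_edges {..<Suc N}" "{N, j} \<in> all_edges {..<Suc N}" using E by auto
    moreover have "{N, i} \<inter> {N, j} \<noteq> {}" by blast
    ultimately have "{N, i} = {N, j}"
      using assms ij(3) unfolding proper_edge_coloring_def by metis
    then show "i = j" by (metis doubleton_eq_iff)
  qed
  moreover have "(\<lambda>j. f {N, j}) ` {..<N} \<subseteq> {..<m}"
    using assms E unfolding proper_edge_coloring_def by blast
  ultimately show ?thesis
    using card_inj_on_le[of "\<lambda>j. f {N, j}" "{..<N}" "{..<m}"] by simp
qed

lemma chromatic_index_complete: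
  assumes "odd N"
  shows "chromatic_index (all_edges {..<Suc N}) = N"
  unfolding chromatic_index_def
proof (rule Least_equality)
  show "\<exists>f. proper_edge_coloring (all_edges {..<Suc N}) {..<N} f"
    using assms by (rule complete_graph_coloring)
  show "N \<le> m" if "\<exists>f. proper_edge_coloring (all_edges {..<Suc N}) {..<m} f" for m
    using that complete_graph_coloring_ge by blast
qed

section \<open>Edge sets and adjacency\<close>

text \<open>Neighbours of \<open>x\<close> correspond to edges through \<open>x\<close>; counting
  incidences from the edges gives two for each.\<close>

lemma handshake:
  assumes "finite V" "E \<subseteq> all_edges V"
  shows "pair_count (\<lambda>x y. {x, y} \<in> E) V V = 2 * card E"
proof -
  have finE: "finite E"
    using assms finite_subset[of E "Pow V"] by (auto simp: all_edges_def)
  have "card {y \<in> V. {x, y} \<in> E} = card {e \<in> E. x \<in> e}" for x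
  proof (rule bij_betw_same_card)
    show "bij_betw (\<lambda>y. {x, y}) {y \<in> V. {x, y} \<in> E} {e \<in> E. x \<in> e}"
      unfolding bij_betw_def
    proof
      show "inj_on (\<lambda>y. {x, y}) {y \<in> V. {x, y} \<in> E}"
        by (auto simp: inj_on_def doubleton_eq_iff)
      have "e \<in> (\<lambda>y. {x, y}) ` {y \<in> V. {x, y} \<in> E}" if e: "e \<in> E" "x \<in> e" for e
      proof -
        obtain a b where "e = {a, b}" "a \<in> V" "b \<in> V"
          using e assms(2) by (meson in_all_edgesE subsetD)
        then show ?thesis using e by (auto simp: insert_commute)
      qed
      then show "(\<lambda>y. {x, y}) ` {y \<in> V. {x, y} \<in> E} = {e \<in> E. x \<in> e}" by auto
    qed
  qed
  then have "pair_count (\<lambda>x y. {x, y} \<in> E) V V = pair_count (\<lambda>x e. x \<in> e) V E"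
    by (simp add: pair_count_def)
  also have "\<dots> = pair_count (\<lambda>e x. x \<in> e) E V"
    using pair_count_swap[OF assms(1) finE] .
  also have "\<dots> = (\<Sum>e\<in>E. 2)"
    unfolding pair_count_def
  proof (rule sum.cong)
    fix e
    assume "e \<in> E"
    then have "e \<subseteq> V" "card e = 2" using assms(2) by (auto simp: all_edges_def)
    moreover have "{x \<in> V. x \<in> e} = e" using \<open>e \<subseteq> V\<close> by blast
    ultimately show "card {x \<in> V. x \<in> e} = 2" by simp
  qed simp
  finally show ?thesis by simp
qed

text \<open>A colour free at both ends could be given to the new edge.\<close>

lemma maximal_edge_coloring_covers:
  assumes E: "E \<subseteq> all_edges V" and max: "maximal_edge_coloring V E C f"
    and xy: "x \<in> V" "y \<in> V" "x \<noteq> y" "{x, y} \<notin> E" and c: "c \<in> C"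
  shows "(\<exists>z. {x, z} \<in> E \<and> f {x, z} = c) \<or> (\<exists>z. {y, z} \<in> E \<and> f {y, z} = c)"
proof (rule ccontr)
  assume free: "\<not> ?thesis"
  have fc: "f e \<noteq> c" if e: "e \<in> E" "e \<inter> {x, y} \<noteq> {}" for e
  proof -
    obtain a b where "e = {a, b}" using e E by (meson in_all_edgesE subsetD)
    then show ?thesis using e free by (auto simp: insert_commute)
  qed
  have "{x, y} \<in> all_edges V - E" using xy by (simp add: pair_in_all_edges)
  then have "\<not> proper_edge_coloring (insert {x, y} E) C (f({x, y} := c))"
    using max c by (simp add: maximal_edge_coloring_def)
  moreover have "proper_edge_coloring E C f" using max by (simp add: maximal_edge_coloring_def)
  then have "proper_edge_coloring (insert {x, y} E) C (f({x, y} := c))"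
    using fc c xy(4) unfolding proper_edge_coloring_def by (auto simp: Int_commute)
  ultimately show False by blast
qed

text \<open>The vertex type is arbitrary, so that both the general statement and the one on
  \<open>MEC\<close> follow.\<close>

lemma no_maximal_edge_coloring:
  fixes V :: "'v set"
  assumes "n \<ge> 10" "n mod 4 = 2" and graph: "simple_graph V E" "card V = n"
    and cE: "card E = n\<^sup>2 div 4 + 1"
  shows "\<not> has_maximal_edge_coloring V E"
proof
  assume "has_maximal_edge_coloring V E"
  define k where "k = n div 2"
  have k: "n = 2 * k" "odd k" "k \<ge> 5" using assms(1,2) unfolding k_def by (presburger, presburger, linarith)
  have "chromatic_index (all_edges {..<n}) = 2 * k - 1"
  proof -
    have "Suc (2 * k - 1) = n" "odd (2 * k - 1)" using k by auto
    then show ?thesis using chromatic_index_complete[of "2 * k - 1"] by simp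
  qed
  then obtain f where f: "maximal_edge_coloring V E {..<2 * k - 1} f"
    using \<open>has_maximal_edge_coloring V E\<close> graph(2) unfolding has_maximal_edge_coloring_def by auto
  have V: "finite V" "E \<subseteq> all_edges V" using graph by (auto simp: simple_graph_def)
  have inE: "x \<in> V \<and> y \<in> V \<and> x \<noteq> y" if "{x, y} \<in> E" for x y
    using subsetD[OF V(2) that] pair_in_all_edges by metis
  have coloring: "proper_edge_coloring E {..<2 * k - 1} f"
    using f by (simp add: maximal_edge_coloring_def)
  interpret maximal_coloring V "\<lambda>x y. {x, y} \<in> E" "\<lambda>x y. f {x, y}" "{..<2 * k - 1}" k
  proof
    show "symp (\<lambda>x y. {x, y} \<in> E)" by (simp add: symp_def insert_commute)
    show "irreflp (\<lambda>x y. {x, y} \<in> E)" by (intro irreflpI notI) (drule inE, blast)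
    show "f {x, y} = f {y, x}" for x y by (simp add: insert_commute)
    show "y = z" if "{x, y} \<in> E" "{x, z} \<in> E" "f {x, y} = f {x, z}" for x y z
    proof -
      have "{x, y} \<inter> {x, z} \<noteq> {}" by blast
      then have "{x, y} = {x, z}"
        using coloring that unfolding proper_edge_coloring_def by metis
      then show ?thesis by (metis doubleton_eq_iff)
    qed
    show "pair_count (\<lambda>x y. {x, y} \<in> E) V V = 2 * k\<^sup>2 + 2"
      using handshake[OF V] cE k by (simp add: power_mult_distrib)
    show "(\<exists>z. {x, z} \<in> E \<and> f {x, z} = c) \<or> (\<exists>z. {y, z} \<in> E \<and> f {y, z} = c)"
      if "x \<in> V" "y \<in> V" "x \<noteq> y" "{x, y} \<notin> E" "c \<in> {..<2 * k - 1}" for x y c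
      using maximal_edge_coloring_covers[OF V(2) f that] .
    show "x \<in> V" if "{x, y} \<in> E" for x y using inE that by blast
    show "f {x, y} \<in> {..<2 * k - 1}" if "{x, y} \<in> E" for x y
      using coloring that unfolding proper_edge_coloring_def by blast
  qed (use V(1) graph(2) k in simp_all)
  show False using no_such_coloring k by blast
qed

theorem theorem4:
  fixes n :: nat
  assumes "n \<ge> 10" and "n mod 4 = 2"
  shows "(\<nexists>(V :: 'a set) E. simple_graph V E \<and> card V = n \<and> card E = n^2 div 4 + 1 \<and>
            has_maximal_edge_coloring V E) \<and>
         n^2 div 4 + 1 \<notin> MEC n"
proof (intro conjI notI)
  assume "\<exists>(V :: 'a set) E. simple_graph V E \<and> card V = n \<and> card E = n^2 div 4 + 1 \<and>
    has_maximal_edge_coloring V E"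
  then show False using no_maximal_edge_coloring[OF assms] by metis
next
  assume "n^2 div 4 + 1 \<in> MEC n"
  then show False using no_maximal_edge_coloring[OF assms] unfolding MEC_def by auto
qed

end
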